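(* There exist topological dynamical systems $(X,F)$ and $(Y,f)$ and a semiconjugacy $\pi:X\to Y$ between $F$ and $f$ (so that $(Y,f)$ is a factor of $(X,F)$, equivalently $(X,F)$ is an extension of $(Y,f)$) such that $(Y,f)$ is distributionally chaotic of type 1 (DC1), while $(X,F)$ has no distributionally scrambled pair of type 1 or of type 2; that is, no pair $(x_1,x_2)\in X^2$ is distributionally scrambled of type 1 for $F$ and no pair $(x_1,x_2)\in X^2$ is distributionally scrambled of type 2 for $F$.
   Context: A topological dynamical system $(X,f)$ consists of a non-empty compact metric space $(X,d)$ and a continuous map $f:X\to X$. A semiconjugacy between $(X,F)$ and $(Y,f)$ is a continuous surjective map $\pi:X\to Y$ with $\pi\circ F=f\circ\pi$; in that case $(Y,f)$ is called a factor of $(X,F)$ and $(X,F)$ an extension of $(Y,f)$. For a system $(X,f)$ with metric $d$, a pair $(x_1,x_2)\in X^2$ and $\delta>0$, define the lower and upper distribution functions $$\Phi_{(x_1,x_2)}(\delta)=\liminf_{m\to\infty}\frac1m\#\{0<k<m:\ d(f^k(x_1),f^k(x_2))<\delta\},$$ $$\Phi^*_{(x_1,x_2)}(\delta)=\limsup_{m\to\infty}\frac1m\#\{0<k<m:\ d(f^k(x_1),f^k(x_2))<\delta\},$$ where $\#A$ is the cardinality of $A$ and $k$ ranges over integers. The notation $\Phi^*_{(x_1,x_2)}\equiv1$ means $\Phi^*_{(x_1,x_2)}(\delta)=1$ for all $\delta>0$. The pair $(x_1,x_2)$ is distributionally scrambled of type 1 if $\Phi^*_{(x_1,x_2)}\equiv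 1$ and $\Phi_{(x_1,x_2)}(\delta)=0$ for some $0<\delta\le\operatorname{diam}X$. The pair $(x_1,x_2)$ is distributionally scrambled of type 2 if $\Phi^*_{(x_1,x_2)}\equiv 1$ and $\Phi_{(x_1,x_2)}<\Phi^*_{(x_1,x_2)}$, where the last inequality means that $\Phi_{(x_1,x_2)}(\delta)<\Phi^*_{(x_1,x_2)}(\delta)$ for some $\delta>0$ (equivalently here, since $\Phi^*_{(x_1,x_2)}\equiv1$ and $\Phi_{(x_1,x_2)}$ is nondecreasing, for all $\delta$ in some interval). The system $(X,f)$ is distributionally chaotic of type 1 (DC1) if there is an uncountable set $S\subset X$ such that every pair of distinct points of $S$ is distributionally scrambled of type 1. *)

theory Defs
  imports "HOL-Analysis.Analysis"
begin

(* Only the values of f on mspace m matter: continuity into mtopology_of m includes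
   the requirement that f maps mspace m into itself. *)
definition topological_dynamical_system :: "'a metric \<Rightarrow> ('a \<Rightarrow> 'a) \<Rightarrow> bool" where
  "topological_dynamical_system m f \<longleftrightarrow>
     mspace m \<noteq> {} \<and> compact_space (mtopology_of m) \<and>
     continuous_map (mtopology_of m) (mtopology_of m) f"

definition semiconjugacy ::
    "'a metric \<Rightarrow> ('a \<Rightarrow> 'a) \<Rightarrow> 'b metric \<Rightarrow> ('b \<Rightarrow> 'b) \<Rightarrow> ('a \<Rightarrow> 'b) \<Rightarrow> bool" where
  "semiconjugacy mX F mY f \<pi> \<longleftrightarrow>
     continuous_map (mtopology_of mX) (mtopology_of mY) \<pi> \<and>
     \<pi> ` mspace mX = mspace mY \<and>
     (\<forall>x\<in>mspace mX. \<pi> (F x) = f (\<pi> x))"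

definition close_frequency ::
    "'a metric \<Rightarrow> ('a \<Rightarrow> 'a) \<Rightarrow> 'a \<Rightarrow> 'a \<Rightarrow> real \<Rightarrow> nat \<Rightarrow> real" where
  "close_frequency m f x1 x2 \<delta> n =
     real (card {k::nat. 0 < k \<and> k < n \<and> mdist m ((f ^^ k) x1) ((f ^^ k) x2) < \<delta>}) / real n"

(* The frequencies are real numbers in [0,1]; ereal is used only because liminf and limsup
   need a complete lattice. *)
definition lower_distribution ::
    "'a metric \<Rightarrow> ('a \<Rightarrow> 'a) \<Rightarrow> 'a \<Rightarrow> 'a \<Rightarrow> real \<Rightarrow> ereal" where
  "lower_distribution m f x1 x2 \<delta> = liminf (\<lambda>n. ereal (close_frequency m f x1 x2 \<delta> n))"

definition upper_distribution ::
    "'a metric \<Rightarrow> ('a \<Rightarrow> 'a) \<Rightarrow> 'a \<Rightarrow> 'a \<Rightarrow> real \<Rightarrow> ereal" where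
  "upper_distribution m f x1 x2 \<delta> = limsup (\<lambda>n. ereal (close_frequency m f x1 x2 \<delta> n))"

(* Counterpart for abstract metrics of the type-class based constant diameter;
   the supremum is meaningful because it is only used for non-empty compact spaces. *)
definition mdiameter :: "'a metric \<Rightarrow> real" where
  "mdiameter m = (SUP (x, y)\<in>mspace m \<times> mspace m. mdist m x y)"

definition dist_scrambled1 :: "'a metric \<Rightarrow> ('a \<Rightarrow> 'a) \<Rightarrow> 'a \<Rightarrow> 'a \<Rightarrow> bool" where
  "dist_scrambled1 m f x1 x2 \<longleftrightarrow>
     (\<forall>\<delta>>0. upper_distribution m f x1 x2 \<delta> = 1) \<and>
     (\<exists>\<delta>>0. \<delta> \<le> mdiameter m \<and> lower_distribution m f x1 x2 \<delta> = 0)"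

definition dist_scrambled2 :: "'a metric \<Rightarrow> ('a \<Rightarrow> 'a) \<Rightarrow> 'a \<Rightarrow> 'a \<Rightarrow> bool" where
  "dist_scrambled2 m f x1 x2 \<longleftrightarrow>
     (\<forall>\<delta>>0. upper_distribution m f x1 x2 \<delta> = 1) \<and>
     (\<exists>\<delta>>0. lower_distribution m f x1 x2 \<delta> < upper_distribution m f x1 x2 \<delta>)"

definition DC1 :: "'a metric \<Rightarrow> ('a \<Rightarrow> 'a) \<Rightarrow> bool" where
  "DC1 m f \<longleftrightarrow>
     (\<exists>S. S \<subseteq> mspace m \<and> uncountable S \<and>
          (\<forall>x1\<in>S. \<forall>x2\<in>S. x1 \<noteq> x2 \<longrightarrow> dist_scrambled1 m f x1 x2))"

(* HOL cannot quantify existentially over types, so the points of a space have to be taken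
   from a fixed type. A compact metric space has at most continuum many points, hence every
   one is isometric to some m of the type below. The metric of m is arbitrary: it need not be
   related to any standard metric or topology on sequences. *)
type_synonym compact_metric_carrier = "nat \<Rightarrow> real"

end

theory Submission
  imports Defs "HOL-Real_Asymp.Real_Asymp"
begin

text \<open>
  A point \<open>(c, t, h, \<theta>)\<close> of the extension carries a label \<open>c\<close> that never changes, so points with
  different labels are never close. The points with \<open>t = 0\<close> are fixed. A point with \<open>t = 1 / s > 0\<close> moves
  by \<open>s \<mapsto> s + 1\<close> towards them while \<open>(h, \<theta>) = (1 + sin (ln (1 + ln s)), sin (ln s))\<close> oscillates more
  and more slowly. Two moving points with the same label are asymptotic. A moving point is not close to
  a fixed point with frequencies tending to 1, even along a subsequence of times, because \<open>\<theta>\<close> runs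
  through a full oscillation while the time grows by a constant factor. Hence no pair is scrambled.

  The factor \<open>(c, t, h, \<theta>) \<mapsto> (t, c * (h + t))\<close> forgets \<open>\<theta>\<close> and forgets \<open>c\<close> in the limit where \<open>h\<close> is near
  0. Two points with different labels and the same \<open>t\<close> then have distance \<open>\<bar>c - c'\<bar> * (h + t)\<close>, and \<open>h\<close>
  varies so slowly that it is almost constant during most of the time up to \<open>n\<close>, alternately near 0 and
  near 2. This makes the points with \<open>t = 1\<close> a scrambled set of type 1. The summand \<open>t\<close> keeps the
  factor map injective on the moving points, whence the dynamics descends.
\<close>

section \<open>Copies of metric subspaces along injections\<close>

text \<open>The carrier type of a system is prescribed, so compact sets of real tuples are copied
  into it. Pulling the metric back along \<open>inv e\<close> makes \<open>e\<close> an isometry on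
  \<open>K\<close>.\<close>

definition embedded_metric :: "('a::metric_space \<Rightarrow> 'b) \<Rightarrow> 'a set \<Rightarrow> 'b metric" where
  "embedded_metric e K = metric (e ` K, \<lambda>x y. dist (inv e x) (inv e y))"

definition conj_map :: "('a \<Rightarrow> 'c) \<Rightarrow> ('b \<Rightarrow> 'd) \<Rightarrow> ('a \<Rightarrow> 'b) \<Rightarrow> 'c \<Rightarrow> 'd" where
  "conj_map e e' f = e' \<circ> f \<circ> inv e"

lemma conj_map_apply: "inj e \<Longrightarrow> conj_map e e' f (e x) = e' (f x)"
  by (simp add: conj_map_def)

lemma funpow_conj_map: "inj e \<Longrightarrow> (conj_map e e f ^^ n) (e x) = e ((f ^^ n) x)"
  by (induction n) (auto simp: conj_map_apply)

lemma Metric_space_embedded: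
  assumes "inj e"
  shows "Metric_space (e ` K) (\<lambda>x y. dist (inv e x) (inv e y))"
  by unfold_locales (use assms in \<open>auto simp: dist_commute dist_triangle\<close>)

lemma mspace_embedded: "inj e \<Longrightarrow> mspace (embedded_metric e K) = e ` K"
  unfolding embedded_metric_def by (rule Metric_space.mspace_metric[OF Metric_space_embedded])

lemma mdist_embedded: "inj e \<Longrightarrow> mdist (embedded_metric e K) (e x) (e y) = dist x y"
  unfolding embedded_metric_def by (simp add: Metric_space.mdist_metric[OF Metric_space_embedded])

lemma homeomorphic_map_embedded:
  assumes "inj e"
  shows "homeomorphic_map (top_of_set K) (mtopology_of (embedded_metric e K)) e"
proof -
  interpret Submetric UNIV dist K by unfold_locales auto
  have "Metric_space12 K dist (e ` K) (\<lambda>x y. dist (inv e x) (inv e y))"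
    by (simp add: Metric_space12_def Metric_space_embedded[OF assms] sub.Metric_space_axioms)
  then have "homeomorphic_map (Metric_space.mtopology K dist)
      (Metric_space.mtopology (e ` K) (\<lambda>x y. dist (inv e x) (inv e y))) e"
    by (rule Metric_space12.isometry_imp_homeomorphic_map) (use assms in auto)
  then show ?thesis
    by (simp add: embedded_metric_def Metric_space.mtopology_of[OF Metric_space_embedded[OF assms]]
        mtopology_submetric)
qed

lemma continuous_map_inv_embedded:
  assumes "inj e"
  shows "continuous_map (mtopology_of (embedded_metric e K)) (top_of_set K) (inv e)"
proof -
  obtain g where g: "homeomorphic_maps (top_of_set K) (mtopology_of (embedded_metric e K)) e g"
    using homeomorphic_map_embedded[OF assms] homeomorphic_map_maps by blast
  then have "continuous_map (mtopology_of (embedded_metric e K)) (top_of_set K) g"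
    by (simp add: homeomorphic_maps_def)
  \<comment> \<open>The inverse \<open>g\<close> supplied by the homeomorphism is abstract, but
    agreement with \<open>inv e\<close> on the image of \<open>K\<close> suffices for continuity
    there.\<close>
  moreover have "g y = inv e y" if "y \<in> topspace (mtopology_of (embedded_metric e K))" for y
  proof -
    from that obtain x where "x \<in> K" "y = e x" using assms by (auto simp: mspace_embedded)
    then show ?thesis using g assms by (auto simp: homeomorphic_maps_def)
  qed
  ultimately show ?thesis by (metis continuous_map_eq)
qed

lemma compact_space_embedded:
  assumes "inj e" "compact K"
  shows "compact_space (mtopology_of (embedded_metric e K))"
  using homeomorphic_map_embedded[OF assms(1), of K] assms(2)
  by (metis compact_space_subtopology compactin_euclidean_iff homeomorphic_compact_space
      homeomorphic_map_imp_homeomorphic_space)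

lemma continuous_map_conj_map:
  assumes "inj e" "inj e'" "continuous_on K f" "f ` K \<subseteq> K'"
  shows "continuous_map (mtopology_of (embedded_metric e K)) (mtopology_of (embedded_metric e' K'))
           (conj_map e e' f)"
proof -
  have "continuous_map (top_of_set K) (top_of_set K') f" using assms by auto
  moreover have "continuous_map (top_of_set K) (top_of_set K') f" using assms by (auto simp: image_subset_iff_funcset)
  moreover have "continuous_map (top_of_set K') (mtopology_of (embedded_metric e' K')) e'"
    using homeomorphic_map_embedded[OF assms(2)] by (simp add: homeomorphic_imp_continuous_map)
  ultimately show ?thesis
    unfolding conj_map_def
    by (intro continuous_map_compose[OF continuous_map_inv_embedded[OF assms(1)]] continuous_map_compose)
qed

section \<open>Frequencies of close times\<close>

text \<open>A pair of orbits matters only through its sequence \<open>D\<close> of distances, so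
  frequencies are studied for arbitrary real sequences.\<close>

definition frequency :: "(nat \<Rightarrow> real) \<Rightarrow> real \<Rightarrow> nat \<Rightarrow> real" where
  "frequency D \<delta> n = real (card {k. 0 < k \<and> k < n \<and> D k < \<delta>}) / real n"

lemma close_frequency_embedded:
  assumes "inj e"
  shows "close_frequency (embedded_metric e K) (conj_map e e f) (e x) (e y) =
         frequency (\<lambda>k. dist ((f ^^ k) x) ((f ^^ k) y))"
  by (intro ext)
    (simp add: close_frequency_def frequency_def funpow_conj_map[OF assms] mdist_embedded[OF assms])

lemma frequency_nonneg: "0 \<le> frequency D \<delta> n"
  by (simp add: frequency_def)

lemma frequency_le_1: "frequency D \<delta> n \<le> 1"
proof -
  have "card {k. 0 < k \<and> k < n \<and> D k < \<delta>} \<le> card {..<n}"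
    by (intro card_mono) auto
  then show ?thesis by (simp add: frequency_def divide_le_eq)
qed

lemma frequency_le_of_far:
  assumes "finite A" "\<And>k. k \<in> A \<Longrightarrow> k < n \<and> \<delta> \<le> D k"
  shows "frequency D \<delta> n \<le> 1 - real (card A) / real n"
proof (cases "n = 0")
  case False
  have "card {k. 0 < k \<and> k < n \<and> D k < \<delta>} \<le> card ({..<n} - A)"
    by (intro card_mono) (use assms in force)+
  also have "\<dots> = n - card A"
    using assms by (subst card_Diff_subset) auto
  finally have "card {k. 0 < k \<and> k < n \<and> D k < \<delta>} \<le> n - card A" .
  moreover have "card A \<le> card {..<n}"
    by (intro card_mono) (use assms in auto)
  ultimately have "real (card {k. 0 < k \<and> k < n \<and> D k < \<delta>}) \<le> real n - real (card A)"
    by simp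
  then show ?thesis using False by (simp add: frequency_def field_simps)
qed (use assms in \<open>auto simp: frequency_def\<close>)

text \<open>The loss is \<open>m + 1\<close> rather than \<open>m\<close> because the time
  \<open>m\<close> is given away: it may be 0, which is never counted.\<close>

lemma frequency_ge_of_close:
  assumes "\<And>k. \<lbrakk>m \<le> k; k < n\<rbrakk> \<Longrightarrow> D k < \<delta>" "n > 0"
  shows "frequency D \<delta> n \<ge> 1 - (real m + 1) / real n"
proof -
  have "card {m + 1..<n} \<le> card {k. 0 < k \<and> k < n \<and> D k < \<delta>}"
    by (intro card_mono) (use assms in auto)
  then have "(real n - (real m + 1)) / real n \<le> frequency D \<delta> n"
    unfolding frequency_def by (intro divide_right_mono) auto
  then show ?thesis using assms(2) by (simp add: diff_divide_distrib)
qed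


lemma limsup_frequency_eq_1:
  assumes "\<And>\<epsilon>. \<epsilon> > 0 \<Longrightarrow> \<exists>\<^sub>F n in sequentially. 1 - \<epsilon> \<le> frequency D \<delta> n"
  shows "limsup (\<lambda>n. ereal (frequency D \<delta> n)) = 1"
proof (rule antisym)
  show "limsup (\<lambda>n. ereal (frequency D \<delta> n)) \<le> 1"
    by (rule Limsup_bounded) (simp add: frequency_le_1)
  show "1 \<le> limsup (\<lambda>n. ereal (frequency D \<delta> n))"
  proof (rule ccontr)
    assume "\<not> 1 \<le> limsup (\<lambda>n. ereal (frequency D \<delta> n))"
    then obtain z where z: "limsup (\<lambda>n. ereal (frequency D \<delta> n)) < ereal z" "ereal z < 1"
      using ereal_dense2 by (metis not_le)
    from Limsup_lessD[OF z(1)] have "\<forall>\<^sub>F n in sequentially. frequency D \<delta> n < z" by simp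
    moreover have "\<exists>\<^sub>F n in sequentially. z \<le> frequency D \<delta> n"
      using assms[of "1 - z"] z(2) by simp
    ultimately show False
      by (auto simp: frequently_def not_le)
  qed
qed

lemma liminf_frequency_eq_0:
  assumes "\<And>\<epsilon>. \<epsilon> > 0 \<Longrightarrow> \<exists>\<^sub>F n in sequentially. frequency D \<delta> n \<le> \<epsilon>"
  shows "liminf (\<lambda>n. ereal (frequency D \<delta> n)) = 0"
proof (rule antisym)
  show "0 \<le> liminf (\<lambda>n. ereal (frequency D \<delta> n))"
    by (rule Liminf_bounded) (simp add: frequency_nonneg)
  show "liminf (\<lambda>n. ereal (frequency D \<delta> n)) \<le> 0"
  proof (rule ccontr)
    assume "\<not> liminf (\<lambda>n. ereal (frequency D \<delta> n)) \<le> 0"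
    then obtain z where z: "ereal z < liminf (\<lambda>n. ereal (frequency D \<delta> n))" "0 < ereal z"
      using ereal_dense2 by (metis not_le)
    from less_LiminfD[OF z(1)] have "\<forall>\<^sub>F n in sequentially. z < frequency D \<delta> n" by simp
    moreover have "\<exists>\<^sub>F n in sequentially. frequency D \<delta> n \<le> z"
      using assms[of z] z(2) by simp
    ultimately show False
      by (auto simp: frequently_def not_le)
  qed
qed

section \<open>Slowly varying and vanishing distance sequences\<close>

text \<open>For large \<open>n\<close>, all but a fraction \<epsilon> of the times up to
  \<open>n\<close> have almost the same value as \<open>n\<close> itself, so the single value
  \<open>D n\<close> controls the frequency at \<open>n\<close>.\<close>

definition slowly_varying :: "(nat \<Rightarrow> real) \<Rightarrow> bool" where
  "slowly_varying D \<longleftrightarrow> (\<forall>\<epsilon>>0. \<forall>\<eta>>0. \<forall>\<^sub>F n in sequentially.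
     \<forall>k. \<epsilon> * real n \<le> real k \<and> k \<le> n \<longrightarrow> \<bar>D k - D n\<bar> < \<eta>)"

lemma slowly_varying_window:
  assumes "slowly_varying D" "\<epsilon> > 0" "\<eta> > 0"
  shows "\<forall>\<^sub>F n in sequentially. n > 0 \<and> (\<exists>m. (real m + 1) / real n \<le> \<epsilon> \<and>
           (\<forall>k. m \<le> k \<and> k \<le> n \<longrightarrow> \<bar>D k - D n\<bar> < \<eta>))"
proof -
  have "\<forall>\<^sub>F n in sequentially. 2 / real n < \<epsilon> / 2"
    using assms(2) by real_asymp
  moreover have "\<forall>\<^sub>F n in sequentially.
      \<forall>k. (\<epsilon>/2) * real n \<le> real k \<and> k \<le> n \<longrightarrow> \<bar>D k - D n\<bar> < \<eta>"
    using assms unfolding slowly_varying_def by (meson half_gt_zero)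
  ultimately show ?thesis
    using eventually_gt_at_top[of 0]
  proof eventually_elim
    case (elim n)
    \<comment> \<open>Half of \<epsilon> fixes the start of the window; the other half absorbs
      \<open>2 / n\<close>, which stems from rounding up and from the \<open>+ 1\<close>.\<close>
    define m where "m = nat \<lceil>(\<epsilon>/2) * real n\<rceil>"
    have m: "(\<epsilon>/2) * real n \<le> real m" "real m \<le> (\<epsilon>/2) * real n + 1"
      using assms(2) unfolding m_def by (auto simp: real_nat_ceiling_ge)
    have "(real m + 1) / real n \<le> ((\<epsilon>/2) * real n + 2) / real n"
      using m by (intro divide_right_mono) auto
    also have "\<dots> = \<epsilon>/2 + 2 / real n" using elim by (simp add: field_simps)
    also have "\<dots> \<le> \<epsilon>" using elim by simp
    finally have "(real m + 1) / real n \<le> \<epsilon>" .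
    moreover have "\<bar>D k - D n\<bar> < \<eta>" if "m \<le> k" "k \<le> n" for k
    proof -
      have "(\<epsilon>/2) * real n \<le> real k" using m(1) that by linarith
      then show ?thesis using elim that by auto
    qed
    ultimately show ?case using elim by blast
  qed
qed

text \<open>Whenever \<open>D n\<close> is below \<open>a\<close> for a large \<open>n\<close>, the
  margin \<delta> - \<open>a\<close> keeps \<open>D\<close> below \<delta> on the whole window
  before \<open>n\<close>.\<close>

lemma limsup_frequency_slowly_varying:
  assumes D: "slowly_varying D" and "\<exists>\<^sub>F n in sequentially. D n < a" "a < \<delta>"
  shows "limsup (\<lambda>n. ereal (frequency D \<delta> n)) = 1"
proof (rule limsup_frequency_eq_1)
  fix \<epsilon> :: real assume "\<epsilon> > 0"
  then have ev: "\<forall>\<^sub>F n in sequentially. n > 0 \<and> (\<exists>m. (real m + 1) / real n \<le> \<epsilon> \<and>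
           (\<forall>k. m \<le> k \<and> k \<le> n \<longrightarrow> \<bar>D k - D n\<bar> < \<delta> - a))"
    using D assms(3) by (intro slowly_varying_window) auto
  show "\<exists>\<^sub>F n in sequentially. 1 - \<epsilon> \<le> frequency D \<delta> n"
  proof (rule frequently_rev_mp[OF assms(2)], rule eventually_mono[OF ev], safe)
    fix n m assume *: "0 < n" "D n < a" "(real m + 1) / real n \<le> \<epsilon>"
      "\<forall>k. m \<le> k \<and> k \<le> n \<longrightarrow> \<bar>D k - D n\<bar> < \<delta> - a"
    have "1 - (real m + 1) / real n \<le> frequency D \<delta> n"
    proof (rule frequency_ge_of_close[OF _ *(1)])
      show "D k < \<delta>" if "m \<le> k" "k < n" for k
        using *(4)[rule_format, of k] *(2) that by linarith
    qed
    with * show "1 - \<epsilon> \<le> frequency D \<delta> n" by linarith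
  qed
qed

text \<open>Whenever \<open>D n\<close> is above \<open>a\<close> for a large \<open>n\<close>, the
  window before \<open>n\<close> contains no close time, so only the small fraction before the
  window can count.\<close>

lemma liminf_frequency_slowly_varying:
  assumes D: "slowly_varying D" and "\<exists>\<^sub>F n in sequentially. a < D n" "\<delta> < a"
  shows "liminf (\<lambda>n. ereal (frequency D \<delta> n)) = 0"
proof (rule liminf_frequency_eq_0)
  fix \<epsilon> :: real assume "\<epsilon> > 0"
  then have ev: "\<forall>\<^sub>F n in sequentially. n > 0 \<and> (\<exists>m. (real m + 1) / real n \<le> \<epsilon> \<and>
           (\<forall>k. m \<le> k \<and> k \<le> n \<longrightarrow> \<bar>D k - D n\<bar> < a - \<delta>))"
    using D assms(3) by (intro slowly_varying_window) auto
  show "\<exists>\<^sub>F n in sequentially. frequency D \<delta> n \<le> \<epsilon>"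
  proof (rule frequently_rev_mp[OF assms(2)], rule eventually_mono[OF ev], safe)
    fix n m assume *: "0 < n" "a < D n" "(real m + 1) / real n \<le> \<epsilon>"
      "\<forall>k. m \<le> k \<and> k \<le> n \<longrightarrow> \<bar>D k - D n\<bar> < a - \<delta>"
    have "frequency D \<delta> n \<le> 1 - real (card {m..<n}) / real n"
    proof (rule frequency_le_of_far)
      fix k assume "k \<in> {m..<n}"
      then show "k < n \<and> \<delta> \<le> D k"
        using *(4)[rule_format, of k] *(2) by auto
    qed simp
    also have "\<dots> \<le> real m / real n"
    proof -
      have "(real n - real (card {m..<n})) / real n \<le> real m / real n"
        by (intro divide_right_mono) auto
      then show ?thesis using *(1) by (simp add: diff_divide_distrib)
    qed
    also have "\<dots> \<le> (real m + 1) / real n" by (intro divide_right_mono) auto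
    finally show "frequency D \<delta> n \<le> \<epsilon>" using * by linarith
  qed
qed

text \<open>This excludes type 2 for asymptotic pairs: the lower distribution function is already 1,
  leaving no room below the upper one.\<close>

lemma liminf_frequency_asymptotic:
  assumes "D \<longlonglongrightarrow> 0" "\<delta> > 0"
  shows "liminf (\<lambda>n. ereal (frequency D \<delta> n)) = 1"
proof -
  obtain m where m: "\<And>k. k \<ge> m \<Longrightarrow> D k < \<delta>"
    using order_tendstoD(2)[OF assms] by (auto simp: eventually_sequentially)
  have "(\<lambda>n. frequency D \<delta> n) \<longlonglongrightarrow> 1"
  proof (rule tendsto_sandwich)
    show "\<forall>\<^sub>F n in sequentially. 1 - (real m + 1) / real n \<le> frequency D \<delta> n"
      using eventually_gt_at_top[of 0] by eventually_elim (auto intro: frequency_ge_of_close m)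
    show "(\<lambda>n. 1 - (real m + 1) / real n) \<longlonglongrightarrow> 1" by real_asymp
  qed (auto simp: frequency_le_1)
  then show ?thesis
    by (intro lim_imp_Liminf) (auto simp: one_ereal_def)
qed

lemma limsup_frequency_less_1:
  assumes "\<forall>\<^sub>F n in sequentially. frequency D \<delta> n \<le> q" "q < 1"
  shows "limsup (\<lambda>n. ereal (frequency D \<delta> n)) < 1"
proof -
  have "limsup (\<lambda>n. ereal (frequency D \<delta> n)) \<le> ereal q"
    by (rule Limsup_bounded) (use assms in simp)
  also have "\<dots> < 1" using assms by simp
  finally show ?thesis .
qed

lemma frequency_eq_0: "(\<And>k. \<delta> \<le> D k) \<Longrightarrow> frequency D \<delta> n = 0"
  by (simp add: frequency_def not_less)

section \<open>The spiral and its drift\<close>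

text \<open>The argument is the logarithmic time \<open>u = ln s\<close>; the components are the
  coordinates \<open>h\<close> and \<theta>.\<close>

definition profile :: "real \<Rightarrow> real \<times> real" where
  "profile u = (1 + sin (ln (1 + u)), sin u)"

lemma abs_sin_diff_le: "\<bar>sin x - sin y\<bar> \<le> \<bar>x - y\<bar>" for x y :: real
proof -
  have "\<bar>sin x - sin y\<bar> = 2 * (\<bar>sin ((x - y) / 2)\<bar> * \<bar>cos ((x + y) / 2)\<bar>)"
    by (simp add: sin_diff_sin abs_mult)
  also have "\<dots> \<le> 2 * (\<bar>(x - y) / 2\<bar> * 1)"
    by (intro mult_left_mono mult_mono abs_sin_x_le_abs_x) auto
  finally show ?thesis by simp
qed

lemma abs_ln_1_plus_diff_le:
  fixes u u' :: real
  assumes "0 \<le> u" "0 \<le> u'"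
  shows "\<bar>ln (1 + u) - ln (1 + u')\<bar> \<le> \<bar>u - u'\<bar>"
proof -
  have *: "ln (1 + x) - ln (1 + y) \<le> x - y" if "0 \<le> y" "y \<le> x" for x y :: real
  proof -
    have "ln (1 + x) - ln (1 + y) \<le> ((1 + x) - (1 + y)) / (1 + y)"
      using that by (intro ln_diff_le) auto
    also have "\<dots> \<le> (x - y) / 1" using that by (intro frac_le) auto
    finally show ?thesis by simp
  qed
  show ?thesis
  proof (cases "u' \<le> u")
    case True
    then have "ln (1 + u') \<le> ln (1 + u)" using assms by simp
    with *[of u' u] True assms show ?thesis by simp
  next
    case False
    then have "ln (1 + u) \<le> ln (1 + u')" using assms by simp
    with *[of u u'] False assms show ?thesis by simp
  qed
qed

text \<open>Each component is 1-Lipschitz in logarithmic time. This gives both the continuity of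
  \<open>step\<close> at \<open>t = 0\<close> and the asymptotic pairs.\<close>

lemma dist_profile_le:
  assumes "0 \<le> u" "0 \<le> u'"
  shows "dist (profile u) (profile u') \<le> 2 * \<bar>u - u'\<bar>"
proof -
  have "dist (profile u) (profile u') =
      norm (sin (ln (1 + u)) - sin (ln (1 + u')), sin u - sin u')"
    by (simp add: profile_def dist_norm)
  also have "\<dots> \<le> \<bar>sin (ln (1 + u)) - sin (ln (1 + u'))\<bar> + \<bar>sin u - sin u'\<bar>"
    using norm_Pair_le by (metis real_norm_def)
  also have "\<dots> \<le> \<bar>u - u'\<bar> + \<bar>u - u'\<bar>"
    using abs_ln_1_plus_diff_le[OF assms] abs_sin_diff_le
    by (intro add_mono) (meson order_trans)+
  finally show ?thesis by simp
qed

lemma profile_in_box: "profile u \<in> {0..2} \<times> {-1..1}"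
  unfolding profile_def by auto (smt (verit) sin_ge_minus_one sin_le_one)+

text \<open>The fibre over \<open>t = 0\<close> is the whole box, so that no limit set of the curve
  has to be computed.\<close>

definition spiral :: "(real \<times> real \<times> real) set" where
  "spiral = {(t, v). t \<in> {0..1} \<and> v \<in> {0..2} \<times> {-1..1} \<and> (t = 0 \<or> v = profile (ln (1 / t)))}"

text \<open>The spiral is an intersection of compact sets: the graph over \<open>{s..1}\<close>
  together with a solid box over \<open>{0..s}\<close>.\<close>

lemma compact_spiral: "compact spiral"
proof -
  let ?A = "\<lambda>s. (\<lambda>t. (t, profile (ln (1 / t)))) ` {s..1} \<union> {0..s} \<times> ({0..2} \<times> {-1..1})"
  have "spiral = \<Inter> (?A ` {0<..1})"
  proof (intro equalityI subsetI)
    fix x assume "x \<in> spiral"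
    then show "x \<in> \<Inter> (?A ` {0<..1})"
      by (auto simp: spiral_def image_iff not_le)
  next
    fix x assume x: "x \<in> \<Inter> (?A ` {0<..1})"
    obtain t v where tv: "x = (t, v)" by (cases x)
    from x have "x \<in> ?A 1" by (rule InterD) auto
    then have t: "t \<in> {0..1}" "v \<in> {0..2} \<times> {-1..1}"
      using profile_in_box by (auto simp: tv)
    have "v = profile (ln (1 / t))" if "t \<noteq> 0"
    proof -
      \<comment> \<open>The choice \<open>s = t / 2\<close> puts \<open>t\<close> outside the solid
        box, so only the graph remains.\<close>
      have "x \<in> ?A (t / 2)"
        using that t by (intro InterD[OF x]) auto
      then show ?thesis using that t by (auto simp: tv)
    qed
    with t show "x \<in> spiral" by (auto simp: spiral_def tv)
  qed
  moreover have "compact (?A s)" if "s \<in> {0<..1}" for s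
  proof -
    have "continuous_on {s..1} (\<lambda>t. (t, profile (ln (1 / t))))"
      unfolding profile_def
    proof (intro continuous_intros ballI)
      show "1 + ln (1 / t) \<noteq> 0" if "t \<in> {s..1}" for t
      proof -
        have "0 \<le> ln (1 / t)" using that \<open>s \<in> {0<..1}\<close> by (intro ln_ge_zero) auto
        then show ?thesis by linarith
      qed
    qed (use that in auto)
    then show ?thesis
      by (intro compact_Un compact_continuous_image compact_Times) auto
  qed
  then have "compact (\<Inter> (?A ` {0<..1}))"
    by (intro compact_Inter) auto
  ultimately show ?thesis by (simp only:)
qed

text \<open>The junk values \<open>1 / 0 = 0\<close> and \<open>ln 0 = 0\<close> make \<open>drift 0 = 0\<close>, so that \<open>step\<close> below fixes the
  points with \<open>t = 0\<close>.\<close>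

definition drift :: "real \<Rightarrow> real \<times> real" where
  "drift t = profile (ln (1 / t + 1)) - profile (ln (1 / t))"

text \<open>In logarithmic time the step from \<open>1 / t\<close> to \<open>1 / t + 1\<close> has
  length \<open>ln (1 + t) \<le> t\<close>; the factor 2 is the Lipschitz constant of
  \<open>profile\<close>.\<close>

lemma norm_drift_le:
  assumes "0 \<le> t" "t \<le> 1"
  shows "norm (drift t) \<le> 2 * t"
proof (cases "t = 0")
  case False
  with assms have "norm (drift t) \<le> 2 * \<bar>ln (1 / t + 1) - ln (1 / t)\<bar>"
    unfolding drift_def dist_norm[symmetric] by (intro dist_profile_le) auto
  also have "1 / t + 1 = (1 + t) / t"
    using False by (simp add: field_simps)
  also have "ln ((1 + t) / t) - ln (1 / t) = ln (1 + t)"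
    using False assms by (simp add: ln_div)
  also have "2 * \<bar>ln (1 + t)\<bar> \<le> 2 * t"
    using assms ln_add_one_self_le_self[of t] by simp
  finally show ?thesis .
qed (simp add: drift_def)

lemma continuous_on_drift: "continuous_on {0..1} drift"
  unfolding continuous_on_eq_continuous_within
proof
  fix t :: real assume t: "t \<in> {0..1}"
  show "continuous (at t within {0..1}) drift"
  proof (cases "t = 0")
    case True
    have "((\<lambda>t. 2 * t) \<longlongrightarrow> 0) (at 0 within {0..1::real})"
      by (auto intro!: tendsto_eq_intros)
    then have "(drift \<longlongrightarrow> 0) (at 0 within {0..1})"
    proof (rule Lim_null_comparison[rotated])
      show "\<forall>\<^sub>F t in at 0 within {0..1}. norm (drift t) \<le> 2 * t"
        unfolding eventually_at_filter by (rule always_eventually) (simp add: norm_drift_le)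
    qed
    then show ?thesis by (simp add: True continuous_within drift_def)
  next
    case False
    have "1 / t \<ge> 1" using False t by simp
    moreover from this have "0 \<le> ln (1 / t)" "0 \<le> ln (1 / t + 1)"
      by (intro ln_ge_zero; linarith)+
    ultimately have "1 + ln (1 / t) \<noteq> 0" "1 + ln (1 / t + 1) \<noteq> 0" "1 / t \<noteq> 0" "1 / t + 1 \<noteq> 0"
      by linarith+
    with False have "isCont drift t"
      unfolding drift_def profile_def by (intro continuous_intros)
    then show ?thesis by (rule continuous_at_imp_continuous_at_within)
  qed
qed

section \<open>The extension and its orbits\<close>

text \<open>With \<open>t = 1 / s\<close>, the map to \<open>t / (1 + t)\<close> is
  \<open>s \<mapsto> s + 1\<close>. Adding the drift instead of evaluating \<open>profile\<close> at
  the new time gives one formula that is continuous across \<open>t = 0\<close>.\<close>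

definition step :: "real \<times> real \<times> real \<times> real \<Rightarrow> real \<times> real \<times> real \<times> real" where
  "step = (\<lambda>(c, t, v). (c, t / (1 + t), v + drift t))"

definition extension :: "(real \<times> real \<times> real \<times> real) set" where
  "extension = {0..1} \<times> spiral"

definition proj :: "real \<times> real \<times> real \<times> real \<Rightarrow> real \<times> real" where
  "proj = (\<lambda>(c, t, v). (t, c * (fst v + t)))"

lemma compact_extension: "compact extension"
  unfolding extension_def by (intro compact_Times compact_spiral) auto

lemma continuous_on_proj: "continuous_on A proj"
  unfolding proj_def case_prod_unfold by (intro continuous_intros)

lemma continuous_on_step: "continuous_on extension step"
proof -
  have "continuous_on extension (\<lambda>x. drift (fst (snd x)))"
    by (rule continuous_on_compose2[OF continuous_on_drift])
      (auto intro!: continuous_intros simp: extension_def spiral_def)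
  then show ?thesis
    unfolding step_def case_prod_unfold
    by (intro continuous_intros) (auto simp: extension_def spiral_def)
qed

lemma funpow_step_fixed: "(step ^^ n) (c, 0, v) = (c, 0, v)"
  by (induction n) (auto simp: step_def drift_def)

text \<open>On the curve the drifts telescope, so an orbit that starts there stays there.\<close>

lemma funpow_step_moving:
  assumes "s > 0"
  shows "(step ^^ n) (c, 1 / s, profile (ln s)) =
         (c, 1 / (s + real n), profile (ln (s + real n)))"
proof (induction n)
  case (Suc n)
  have "1 / (s + real n) / (1 + 1 / (s + real n)) = 1 / (1 + s + real n)"
    using assms by (simp add: field_simps)
  then show ?case
    using Suc by (simp add: step_def drift_def add_ac)
qed simp

lemma extension_cases:
  assumes "x \<in> extension"
  obtains (fixed) c h \<theta> where "x = (c, 0, h, \<theta>)"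
  | (moving) c s where "s \<ge> 1" "x = (c, 1 / s, profile (ln s))"
proof -
  obtain c t h \<theta> where x: "x = (c, t, h, \<theta>)" by (cases x)
  show thesis
  proof (cases "t = 0")
    case False
    then have "1 / t \<ge> 1" "x = (c, 1 / (1 / t), profile (ln (1 / t)))"
      using assms by (auto simp: x extension_def spiral_def)
    then show ?thesis by (rule moving)
  qed (use x fixed in simp)
qed

lemma moving_in_extension:
  assumes "s \<ge> 1" "c \<in> {0..1}"
  shows "(c, 1 / s, profile (ln s)) \<in> extension"
  using assms profile_in_box[of "ln s"] by (auto simp: extension_def spiral_def)

lemma step_in_extension:
  assumes "x \<in> extension"
  shows "step x \<in> extension"
  using assms
proof (cases rule: extension_cases)
  case (fixed c h \<theta>)
  then show ?thesis using assms funpow_step_fixed[of 1] by simp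
next
  case (moving c s)
  then have "step x = (c, 1 / (s + 1), profile (ln (s + 1)))"
    using funpow_step_moving[of s 1 c] by simp
  then show ?thesis
    using moving moving_in_extension[of "s + 1" c] assms by (simp add: extension_def)
qed

section \<open>Pairs of orbits in the extension\<close>

text \<open>The logarithmic times \<open>ln (s + k)\<close> and \<open>ln (s' + k)\<close> approach
  each other, and \<open>profile\<close> is Lipschitz in them.\<close>

lemma dist_moving_tendsto_0:
  assumes "s \<ge> 1" "s' \<ge> 1"
  shows "(\<lambda>k. dist ((step ^^ k) (c, 1 / s, profile (ln s)))
                   ((step ^^ k) (c, 1 / s', profile (ln s')))) \<longlonglongrightarrow> 0"
proof -
  have "(\<lambda>k. dist (profile (ln (s + real k))) (profile (ln (s' + real k)))) \<longlonglongrightarrow> 0"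
  proof (rule tendsto_sandwich[OF _ _ tendsto_const])
    show "\<forall>\<^sub>F k in sequentially. dist (profile (ln (s + real k))) (profile (ln (s' + real k)))
        \<le> 2 * \<bar>ln (s + real k) - ln (s' + real k)\<bar>"
      using assms by (intro always_eventually allI dist_profile_le) auto
    show "(\<lambda>k. 2 * \<bar>ln (s + real k) - ln (s' + real k)\<bar>) \<longlonglongrightarrow> 0"
      by (intro tendsto_mult_right_zero tendsto_rabs_zero) real_asymp
  qed auto
  moreover have "(\<lambda>k. dist (1 / (s + real k)) (1 / (s' + real k))) \<longlonglongrightarrow> 0"
    unfolding dist_real_def by (intro tendsto_rabs_zero) real_asymp
  \<comment> \<open>The nested roots are the distance in nested products; the common label
    contributes the outer 0.\<close>
  ultimately have "(\<lambda>k. sqrt (0\<^sup>2 + (sqrt ((dist (1 / (s + real k)) (1 / (s' + real k)))\<^sup>2 +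
      (dist (profile (ln (s + real k))) (profile (ln (s' + real k))))\<^sup>2))\<^sup>2)) \<longlonglongrightarrow> sqrt (0\<^sup>2 + (sqrt (0\<^sup>2 + 0\<^sup>2))\<^sup>2)"
    by (intro tendsto_intros)
  then show ?thesis
    using assms by (simp add: funpow_step_moving dist_Pair_Pair)
qed

lemma exists_sin_eq_window:
  fixes \<sigma> a :: real
  assumes "\<sigma> = 1 \<or> \<sigma> = - 1"
  obtains b where "a - 2 * pi \<le> b" "b \<le> a" "sin b = \<sigma>"
proof -
  define b0 where "b0 = \<sigma> * pi / 2"
  define j where "j = \<lfloor>(a - b0) / (2 * pi)\<rfloor>"
  define b where "b = b0 + 2 * pi * of_int j"
  have "of_int j \<le> (a - b0) / (2 * pi)" "(a - b0) / (2 * pi) < of_int j + 1"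
    by (auto simp: j_def)
  then have "b \<le> a" "a - 2 * pi \<le> b"
    unfolding b_def by (auto simp: field_simps)
  moreover have "sin b = \<sigma>"
    using assms by (auto simp: b_def b0_def sin_add)
  ultimately show thesis using that by blast
qed

text \<open>In each window of logarithmic length \<open>2 * pi\<close> the wave \<open>sin\<close> takes the value \<open>1\<close> or
  \<open>- 1\<close> that is at distance at least 1 from \<open>\<theta>\<close>, and stays away from \<open>\<theta>\<close> on a part of the
  window that has positive density.\<close>

lemma frequency_moving_fixed:
  fixes s \<theta> :: real
  assumes "s \<ge> 1" and far: "\<And>k. \<bar>sin (ln (s + real k)) - \<theta>\<bar> \<le> D k"
  shows "\<exists>q<1. \<forall>\<^sub>F n in sequentially. frequency D (1/2) n \<le> q"
proof -
  define \<sigma> :: real where "\<sigma> = (if \<theta> \<le> 0 then 1 else - 1)"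
  \<comment> \<open>With \<open>b\<close> in a window of length \<open>2 * pi\<close> ending at
    \<open>ln n - 1\<close>, the time \<open>exp b\<close> is at least \<kappa> times
    \<open>n\<close>.\<close>
  define \<kappa> where "\<kappa> = exp (- 1 - 2 * pi)"
  have \<kappa>: "\<kappa> > 0" by (simp add: \<kappa>_def)
  have "\<forall>\<^sub>F n in sequentially. \<kappa> * real n > s \<and> \<kappa> / 2 - 1 / real n > \<kappa> / 4 \<and> n > 0"
    using \<kappa> by (intro eventually_conj eventually_gt_at_top) real_asymp+
  then have "\<forall>\<^sub>F n in sequentially. frequency D (1/2) n \<le> 1 - \<kappa> / 4"
  proof eventually_elim
    case (elim n)
    have "\<sigma> = 1 \<or> \<sigma> = - 1" by (simp add: \<sigma>_def)
    \<comment> \<open>Ending the window at \<open>ln n - 1\<close> leaves room for the stretch from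
      \<open>b\<close> to \<open>b + 1/2\<close> below \<open>ln n\<close>.\<close>
    then obtain b where b: "ln (real n) - 1 - 2 * pi \<le> b" "b \<le> ln (real n) - 1" "sin b = \<sigma>"
      by (rule exists_sin_eq_window)
    have eb: "\<kappa> * real n \<le> exp b"
    proof -
      have "\<kappa> * real n = exp (ln (real n) - 1 - 2 * pi)"
        using elim by (simp add: \<kappa>_def exp_add exp_diff exp_minus field_simps)
      also have "\<dots> \<le> exp b" using b by simp
      finally show ?thesis .
    qed
    define l where "l = nat \<lceil>exp b - s\<rceil>"
    define r where "r = nat \<lfloor>exp (b + 1/2) - s\<rfloor>"
    \<comment> \<open>The stretch therefore lasts at least \<open>exp b / 2\<close>, hence at least
      \<kappa> / 2 times \<open>n\<close>; rounding its ends costs at most 1.\<close>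
    have ebb: "exp (b + 1/2) \<ge> exp b * (3/2)"
    proof -
      have "exp (1/2::real) \<ge> 3/2" using exp_ge_add_one_self[of "1/2"] by simp
      then show ?thesis by (simp add: exp_add)
    qed
    have pos: "exp b - s > 0" using eb elim by linarith
    have l: "exp b - s \<le> real l" "real l < exp b - s + 1"
      using pos unfolding l_def by linarith+
    have r: "real r \<le> exp (b + 1/2) - s" "exp (b + 1/2) - s - 1 < real r"
      using pos ebb exp_gt_zero[of b] unfolding r_def by linarith+
    have "frequency D (1/2) n \<le> 1 - real (card {l..r}) / real n"
    proof (rule frequency_le_of_far)
      fix k assume k: "k \<in> {l..r}"
      have s: "s + real k > 0" using assms by linarith
      have "exp b \<le> s + real k" "s + real k \<le> exp (b + 1/2)" using k l r by auto
      then have ln: "b \<le> ln (s + real k)" "ln (s + real k) \<le> b + 1/2"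
        using s by (auto simp: ln_ge_iff) (metis exp_gt_zero ln_exp ln_le_cancel_iff)
      have "exp (b + 1/2) < exp (ln (real n))" using b by (subst exp_less_cancel_iff) linarith
      then have "k < n" using \<open>s + real k \<le> exp (b + 1/2)\<close> elim assms by simp
      \<comment> \<open>At \<open>b\<close> the wave is at distance at least 1 from \<theta>, and
        within logarithmic time 1/2 it moves by at most 1/2.\<close>
      moreover have "1/2 \<le> D k"
        using abs_sin_diff_le[of "ln (s + real k)" b] ln b(3) far[of k]
        by (auto simp: \<sigma>_def split: if_splits)
      ultimately show "k < n \<and> 1/2 \<le> D k" by simp
    qed simp
    also have "\<dots> \<le> 1 - \<kappa> / 4"
    proof -
      have "\<kappa> / 2 * real n - 1 \<le> real (card {l..r})"
        using l r ebb eb by simp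
      then have "(\<kappa> / 2 * real n - 1) / real n \<le> real (card {l..r}) / real n"
        by (intro divide_right_mono) auto
      moreover have "(\<kappa> / 2 * real n - 1) / real n = \<kappa> / 2 - 1 / real n"
        using elim by (simp add: field_simps)
      ultimately show ?thesis using elim by linarith
    qed
    finally show ?case .
  qed
  then show ?thesis using \<kappa> by (intro exI[of _ "1 - \<kappa> / 4"]) auto
qed

lemma fst_funpow_step: "fst ((step ^^ n) x) = fst x"
  by (induction n) (auto simp: step_def case_prod_unfold)

text \<open>Different labels, or different fixed points, stay a constant apart; a moving and a fixed
  point are separated by the wave; two moving points with one label are asymptotic. Either
  alternative contradicts type 2.\<close>

lemma frequency_dichotomy:
  assumes "x \<in> extension" "y \<in> extension"
  defines "D \<equiv> \<lambda>k. dist ((step ^^ k) x) ((step ^^ k) y)"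
  shows "(\<exists>\<delta>>0. limsup (\<lambda>n. ereal (frequency D \<delta> n)) < 1) \<or> D \<longlonglongrightarrow> 0"
proof -
  have bounded_away: ?thesis if "\<delta> > 0" "\<And>k. \<delta> \<le> D k" for \<delta>
    using that by (intro disjI1 exI[of _ \<delta>] conjI limsup_frequency_less_1[where q = 0])
      (auto simp: frequency_eq_0)
  \<comment> \<open>The distance enters through a hypothesis so that symmetry covers both orders of
    the moving and the fixed point.\<close>
  have wave: ?thesis
    if "s \<ge> 1" "\<And>k. dist ((step ^^ k) (c, 1 / s, profile (ln s))) (c, 0, h, \<theta>) = D k" for c s h \<theta>
  proof -
    have "\<bar>sin (ln (s + real k)) - \<theta>\<bar> \<le> D k" for k
    proof -
      let ?z = "(step ^^ k) (c, 1 / s, profile (ln s))" and ?w = "(c, 0::real, h, \<theta>)"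
      have "\<bar>sin (ln (s + real k)) - \<theta>\<bar> = dist (snd (snd (snd ?z))) (snd (snd (snd ?w)))"
        using that(1) funpow_step_moving[of s k c] by (simp add: profile_def dist_real_def)
      also have "\<dots> \<le> dist ?z ?w"
        by (meson dist_snd_le order_trans)
      finally show ?thesis using that by simp
    qed
    from frequency_moving_fixed[OF that(1) this]
    obtain q where "q < 1" "\<forall>\<^sub>F n in sequentially. frequency D (1/2) n \<le> q" by blast
    then have "limsup (\<lambda>n. ereal (frequency D (1/2) n)) < 1"
      by (intro limsup_frequency_less_1)
    then show ?thesis by (intro disjI1 exI[of _ "1/2"]) simp
  qed
  show ?thesis
  proof (cases "fst x = fst y")
    case False
    show ?thesis
    proof (rule bounded_away)
      show "dist (fst x) (fst y) \<le> D k" for k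
        unfolding D_def by (metis dist_fst_le fst_funpow_step)
    qed (use False in simp)
  next
    case True
    from assms(1) show ?thesis
    proof (cases rule: extension_cases)
      case (fixed c h \<theta>)
      note x = this
      from assms(2) show ?thesis
      proof (cases rule: extension_cases)
        case (fixed c' h' \<theta>')
        then have "D = (\<lambda>k. dist x y)" using x by (simp add: D_def funpow_step_fixed)
        then show ?thesis using bounded_away[of "dist x y"] by (cases "x = y") auto
      next
        case (moving c' s)
        then show ?thesis using x True
          by (intro wave[of s c h \<theta>]) (auto simp: D_def funpow_step_fixed dist_commute)
      qed
    next
      case (moving c s)
      note x = this
      from assms(2) show ?thesis
      proof (cases rule: extension_cases)
        case (fixed c' h' \<theta>')
        then show ?thesis using x True
          by (intro wave[of s c h' \<theta>']) (auto simp: D_def funpow_step_fixed)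
      next
        case (moving c' s')
        then show ?thesis using x True dist_moving_tendsto_0[of s s' c] by (simp add: D_def)
      qed
    qed
  qed
qed

text \<open>The threshold that witnesses type 1 also witnesses type 2, since there 0 < 1.\<close>

lemma dist_scrambled1_imp_2: "dist_scrambled1 m f x y \<Longrightarrow> dist_scrambled2 m f x y"
  unfolding dist_scrambled1_def dist_scrambled2_def by fastforce

lemma not_dist_scrambled2_extension:
  assumes "inj e" "x \<in> extension" "y \<in> extension"
  shows "\<not> dist_scrambled2 (embedded_metric e extension) (conj_map e e step) (e x) (e y)"
proof
  let ?D = "\<lambda>k. dist ((step ^^ k) x) ((step ^^ k) y)"
  assume "dist_scrambled2 (embedded_metric e extension) (conj_map e e step) (e x) (e y)"
  then have sup: "\<And>\<delta>. \<delta> > 0 \<Longrightarrow> limsup (\<lambda>n. ereal (frequency ?D \<delta> n)) = 1"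
    and inf: "\<exists>\<delta>>0. liminf (\<lambda>n. ereal (frequency ?D \<delta> n)) < limsup (\<lambda>n. ereal (frequency ?D \<delta> n))"
    unfolding dist_scrambled2_def upper_distribution_def lower_distribution_def
      close_frequency_embedded[OF assms(1)] by auto
  from frequency_dichotomy[OF assms(2,3)] show False
  proof
    assume "\<exists>\<delta>>0. limsup (\<lambda>n. ereal (frequency ?D \<delta> n)) < 1"
    with sup show False by auto
  next
    assume "?D \<longlonglongrightarrow> 0"
    then show False using inf sup liminf_frequency_asymptotic by auto
  qed
qed

section \<open>Slow oscillation of distances in the factor\<close>

text \<open>Up to the factor \<open>\<bar>c - c'\<bar>\<close> this is the distance at time \<open>k\<close> of the images in the factor of two points
  that start at \<open>t = 1\<close> with labels \<open>c\<close> and \<open>c'\<close>.\<close>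

definition gap :: "nat \<Rightarrow> real" where
  "gap k = 1 + sin (ln (1 + ln (1 + real k))) + 1 / (1 + real k)"

lemma gap_pos: "gap k > 0"
proof -
  have "0 < 1 / (1 + real k)" by simp
  then show ?thesis
    unfolding gap_def using sin_ge_minus_one[of "ln (1 + ln (1 + real k))"] by linarith
qed

text \<open>The phase of the sine is a double logarithm, which a constant factor in time changes by
  an amount tending to 0.\<close>

lemma slowly_varying_gap:
  assumes "a \<ge> 0"
  shows "slowly_varying (\<lambda>k. a * gap k)"
  unfolding slowly_varying_def
proof (intro allI impI)
  fix \<epsilon> \<eta> :: real assume "\<epsilon> > 0" "\<eta> > 0"
  \<comment> \<open>By monotonicity, the phase change between \<open>k\<close> and \<open>n\<close>
    is at most that over the whole window; the last summand bounds the change of the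
    reciprocal.\<close>
  define B where "B n = ln (1 + ln (1 + real n)) - ln (1 + ln (1 + \<epsilon> * real n)) + 1 / (1 + \<epsilon> * real n)" for n :: nat
  have "B \<longlonglongrightarrow> 0" unfolding B_def using \<open>\<epsilon> > 0\<close> by real_asymp
  then have "(\<lambda>n. a * B n) \<longlonglongrightarrow> 0" by (rule tendsto_mult_right_zero)
  then have "\<forall>\<^sub>F n in sequentially. a * B n < \<eta>"
    using \<open>\<eta> > 0\<close> by (rule order_tendstoD)
  then show "\<forall>\<^sub>F n in sequentially. \<forall>k. \<epsilon> * real n \<le> real k \<and> k \<le> n \<longrightarrow> \<bar>a * gap k - a * gap n\<bar> < \<eta>"
  proof eventually_elim
    case (elim n)
    show ?case
    proof (intro allI impI, elim conjE)
      fix k assume k: "\<epsilon> * real n \<le> real k" "k \<le> n"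
      have nonneg: "0 \<le> \<epsilon> * real n" using \<open>\<epsilon> > 0\<close> by simp
      have ln_pos: "0 \<le> ln (1 + x)" if "0 \<le> x" for x :: real using that by (intro ln_ge_zero) auto
      have "ln (1 + \<epsilon> * real n) \<le> ln (1 + real k)" "ln (1 + real k) \<le> ln (1 + real n)"
        using k nonneg by auto
      then have "ln (1 + ln (1 + \<epsilon> * real n)) \<le> ln (1 + ln (1 + real k))"
          "ln (1 + ln (1 + real k)) \<le> ln (1 + ln (1 + real n))"
        using ln_pos[OF nonneg] ln_pos[of "real k"] ln_pos[of "real n"]
        by (auto intro!: ln_mono add_pos_nonneg)
      then have "\<bar>sin (ln (1 + ln (1 + real k))) - sin (ln (1 + ln (1 + real n)))\<bar>
          \<le> ln (1 + ln (1 + real n)) - ln (1 + ln (1 + \<epsilon> * real n))"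
        using abs_sin_diff_le[of "ln (1 + ln (1 + real k))" "ln (1 + ln (1 + real n))"] by linarith
      moreover have "1 / (1 + real k) \<le> 1 / (1 + \<epsilon> * real n)" "1 / (1 + real n) \<le> 1 / (1 + real k)"
          "0 \<le> 1 / (1 + real n)"
        using k nonneg by (auto intro!: divide_left_mono mult_pos_pos add_pos_nonneg)
      ultimately have "\<bar>gap k - gap n\<bar> \<le> B n"
        unfolding gap_def B_def by linarith
      then have "a * \<bar>gap k - gap n\<bar> \<le> a * B n" using assms by (rule mult_left_mono)
      then show "\<bar>a * gap k - a * gap n\<bar> < \<eta>"
        using elim assms by (simp add: abs_mult right_diff_distrib[symmetric])
    qed
  qed
qed

lemma frequently_gap_near:
  fixes \<sigma> :: real
  assumes "\<sigma> = 1 \<or> \<sigma> = - 1" "\<eta> > 0"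
  shows "\<exists>\<^sub>F n in sequentially. \<bar>gap n - (1 + \<sigma>)\<bar> < \<eta>"
  unfolding frequently_sequentially
proof
  fix N
  \<comment> \<open>The window starts at a large value: \<open>N\<close> pushes \<open>n\<close>
    beyond \<open>N\<close>, and 2 / \<eta> makes the errors small.\<close>
  obtain b where "real N + 2 / \<eta> + 1 + 2 * pi - 2 * pi \<le> b" "sin b = \<sigma>"
    by (rule exists_sin_eq_window[OF assms(1)])
  then have b: "real N + 2 / \<eta> + 1 \<le> b" "sin b = \<sigma>" by simp_all
  \<comment> \<open>This solves \<open>ln (1 + ln r) = b\<close>. Rounding to \<open>n\<close>
    shifts the phase by at most \<open>1 / r\<close>, and the reciprocal in \<open>gap\<close> adds
    at most another \<open>1 / r\<close>; together they stay below \<eta>.\<close>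
  define r where "r = exp (exp b - 1)"
  define n where "n = nat \<lfloor>r\<rfloor>"
  have "b \<le> exp b - 1" "exp b - 1 \<le> r"
    using exp_ge_add_one_self[of b] exp_ge_add_one_self[of "exp b - 1"] unfolding r_def by linarith+
  with b have r: "real N + 2 / \<eta> + 1 \<le> r" by linarith
  have "2 / \<eta> > 0" using assms(2) by simp
  then have "b > 0" using b(1) by linarith
  have "r > 0" by (simp add: r_def)
  then have "real n = of_int \<lfloor>r\<rfloor>" by (simp add: n_def)
  then have n: "r \<le> 1 + real n" "real n \<le> r" by linarith+
  have "N \<le> n"
    unfolding n_def by (rule le_nat_floor) (use r \<open>2 / \<eta> > 0\<close> in linarith)
  have "ln r = exp b - 1" by (simp add: r_def)
  then have lnr: "0 \<le> ln r" "ln (1 + ln r) = b" using \<open>b > 0\<close> by simp_all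
  have "ln r \<le> ln (1 + real n)" using n(1) \<open>r > 0\<close> by (intro ln_mono)
  have "ln (1 + real n) - ln r \<le> 1 / r"
  proof -
    have "ln (1 + real n) - ln r \<le> (1 + real n - r) / r"
      using \<open>r > 0\<close> by (intro ln_diff_le) auto
    also have "\<dots> \<le> 1 / r" using n \<open>r > 0\<close> by (intro divide_right_mono) auto
    finally show ?thesis .
  qed
  moreover have "\<bar>ln (1 + ln (1 + real n)) - ln (1 + ln r)\<bar> \<le> \<bar>ln (1 + real n) - ln r\<bar>"
    by (intro abs_ln_1_plus_diff_le) (use lnr in auto)
  ultimately have "\<bar>sin (ln (1 + ln (1 + real n))) - \<sigma>\<bar> \<le> 1 / r"
    using abs_sin_diff_le[of "ln (1 + ln (1 + real n))" b] \<open>ln r \<le> ln (1 + real n)\<close>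
    unfolding lnr(2) b(2) by linarith
  moreover have "1 / (1 + real n) \<le> 1 / r" using n \<open>r > 0\<close> by (intro divide_left_mono) auto
  moreover have "1 / r < \<eta> / 2"
  proof -
    have "2 / \<eta> < r" using r by linarith
    then show ?thesis using \<open>r > 0\<close> assms(2) by (simp add: field_simps)
  qed
  moreover have "0 \<le> 1 / (1 + real n)" by simp
  ultimately have "\<bar>gap n - (1 + \<sigma>)\<bar> < \<eta>" unfolding gap_def by linarith
  then show "\<exists>n\<ge>N. \<bar>gap n - (1 + \<sigma>)\<bar> < \<eta>" using \<open>N \<le> n\<close> by blast
qed

text \<open>The value of \<open>gap\<close> returns arbitrarily close to 0. Dividing by
  \<open>a + 1\<close> instead of \<open>a\<close> covers \<open>a = 0\<close> as well.\<close>

lemma limsup_frequency_gap: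
  assumes "a \<ge> 0" "\<delta> > 0"
  shows "limsup (\<lambda>n. ereal (frequency (\<lambda>k. a * gap k) \<delta> n)) = 1"
proof (rule limsup_frequency_slowly_varying[OF slowly_varying_gap[OF assms(1)]])
  show "\<exists>\<^sub>F n in sequentially. a * gap n < \<delta> / 2"
  proof (rule frequently_mono[rotated])
    show "\<exists>\<^sub>F n in sequentially. \<bar>gap n - (1 + - 1)\<bar> < \<delta> / (2 * (a + 1))"
      by (rule frequently_gap_near) (use assms in auto)
    have "a * gap n < \<delta> / 2" if "\<bar>gap n\<bar> < \<delta> / (2 * (a + 1))" for n
    proof -
      have "a * gap n \<le> (a + 1) * gap n" using gap_pos[of n] by (simp add: algebra_simps)
      also have "\<dots> < (a + 1) * (\<delta> / (2 * (a + 1)))"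
        using that assms by (intro mult_strict_left_mono) auto
      also have "\<dots> = \<delta> / 2" using assms by (simp add: field_simps)
      finally show ?thesis .
    qed
    then show "\<forall>n. \<bar>gap n - (1 + - 1)\<bar> < \<delta> / (2 * (a + 1)) \<longrightarrow> a * gap n < \<delta> / 2" by simp
  qed
qed (use assms in auto)

text \<open>Near its value 2, \<open>gap\<close> exceeds 3/2, which leaves a margin above the
  threshold \<open>a\<close>.\<close>

lemma liminf_frequency_gap:
  assumes "a > 0"
  shows "liminf (\<lambda>n. ereal (frequency (\<lambda>k. a * gap k) a n)) = 0"
proof (rule liminf_frequency_slowly_varying[OF slowly_varying_gap])
  show "\<exists>\<^sub>F n in sequentially. a * (3/2) < a * gap n"
    by (rule frequently_mono[OF _ frequently_gap_near[of 1 "1/2"]])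
      (use assms in \<open>auto simp: abs_if split: if_splits\<close>)
qed (use assms in auto)

section \<open>The factor system and its scrambled set\<close>

text \<open>The coordinate \<open>t\<close> survives \<open>proj\<close>. If \<open>t = 0\<close>,
  both points are fixed; otherwise \<open>t\<close> determines \<open>s\<close>, and
  \<open>h + t > 0\<close> allows the label to be recovered, so the points coincide.\<close>

lemma proj_step_cong:
  assumes "x \<in> extension" "y \<in> extension" "proj x = proj y"
  shows "proj (step x) = proj (step y)"
  using assms(1)
proof (cases rule: extension_cases)
  case (fixed c h \<theta>)
  note x = this
  from assms(2) show ?thesis
  proof (cases rule: extension_cases)
    case (fixed c' h' \<theta>')
    then show ?thesis
      using x assms(3) funpow_step_fixed[of 1] by simp
  qed (use x assms(3) in \<open>auto simp: proj_def\<close>)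
next
  case (moving c s)
  note x = this
  from assms(2) show ?thesis
  proof (cases rule: extension_cases)
    case (moving c' s')
    then have "s = s'" using x assms(3) by (auto simp: proj_def)
    moreover have "fst (profile (ln s)) + 1 / s > 0"
      using profile_in_box[of "ln s"] x(1) by (auto simp: mem_Times_iff intro!: add_nonneg_pos)
    ultimately have "x = y" using x moving assms(3) by (auto simp: proj_def)
    then show ?thesis by simp
  qed (use x assms(3) in \<open>auto simp: proj_def\<close>)
qed

text \<open>A continuous surjection from a compact space onto a Hausdorff space is a quotient map,
  so \<open>proj \<circ> step\<close>, being constant on the fibres of \<open>proj\<close>, descends
  to a continuous map.\<close>

lemma factor_map_exists:
  obtains f where "continuous_on (proj ` extension) f" "f ` (proj ` extension) \<subseteq> proj ` extension"
    "\<And>x. x \<in> extension \<Longrightarrow> f (proj x) = proj (step x)"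
proof -
  let ?Y = "top_of_set (proj ` extension)"
  have quotient: "quotient_map (top_of_set extension) ?Y proj"
    by (rule T1_Spaces.continuous_imp_quotient_map)
      (auto simp: continuous_on_proj compact_extension compact_space_subtopology
        Hausdorff_space_subtopology)
  have cont: "continuous_map (top_of_set extension) ?Y (proj \<circ> step)"
    using continuous_on_compose[OF continuous_on_step continuous_on_proj]
      step_in_extension by (auto intro!: imageI)
  obtain f where "continuous_map ?Y ?Y f"
    "\<And>x. x \<in> topspace (top_of_set extension) \<Longrightarrow> f (proj x) = (proj \<circ> step) x"
  proof (rule quotient_map_lift_exists[OF quotient cont])
    show "(proj \<circ> step) x = (proj \<circ> step) y"
      if "x \<in> topspace (top_of_set extension)" "y \<in> topspace (top_of_set extension)"
        "proj x = proj y" for x y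
      using that by (auto intro: proj_step_cong)
  qed (rule that)
  then show thesis
    by (intro that[of f]) (auto simp: image_subset_iff intro!: imageI step_in_extension)
qed

lemma funpow_factor:
  assumes "\<And>x. x \<in> extension \<Longrightarrow> f (proj x) = proj (step x)" "x \<in> extension"
  shows "(f ^^ n) (proj x) = proj ((step ^^ n) x)"
proof -
  have "(step ^^ n) x \<in> extension" for n
    by (induction n) (auto simp: assms(2) step_in_extension)
  then show ?thesis by (induction n) (auto simp: assms(1))
qed

text \<open>The orbit starts at \<open>s = 1\<close>; the forms \<open>1 / 1\<close> and
  \<open>ln 1\<close> match the lemmas on moving points.\<close>

definition scrambled_point :: "real \<Rightarrow> real \<times> real" where
  "scrambled_point c = proj (c, 1 / 1, profile (ln 1))"

text \<open>The two orbits share the coordinate \<open>t\<close> at every time, so only the second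
  coordinates differ.\<close>

lemma dist_scrambled_point:
  assumes "\<And>x. x \<in> extension \<Longrightarrow> f (proj x) = proj (step x)" "c \<in> {0..1}" "c' \<in> {0..1}"
  shows "dist ((f ^^ k) (scrambled_point c)) ((f ^^ k) (scrambled_point c')) = \<bar>c - c'\<bar> * gap k"
proof -
  have eq: "(f ^^ k) (scrambled_point b) = (1 / (1 + real k), b * gap k)" if "b \<in> {0..1}" for b
  proof -
    have "(f ^^ k) (scrambled_point b) = proj ((step ^^ k) (b, 1 / 1, profile (ln 1)))"
      unfolding scrambled_point_def
      by (rule funpow_factor[OF assms(1) moving_in_extension]) (use that in auto)
    also have "(step ^^ k) (b, 1 / 1, profile (ln 1)) =
        (b, 1 / (1 + real k), profile (ln (1 + real k)))"
      by (rule funpow_step_moving) simp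
    finally show ?thesis by (simp add: proj_def profile_def gap_def)
  qed
  have "\<bar>c * gap k - c' * gap k\<bar> = \<bar>c - c'\<bar> * gap k"
    using gap_pos[of k] by (simp add: left_diff_distrib[symmetric] abs_mult)
  then show ?thesis using assms by (simp add: eq dist_Pair_Pair dist_real_def)
qed

lemma dist_le_mdiameter:
  assumes "compact_space (mtopology_of m)" "x \<in> mspace m" "y \<in> mspace m"
  shows "mdist m x y \<le> mdiameter m"
proof -
  interpret Metric_space "mspace m" "mdist m" by simp
  have "mbounded (mspace m)"
    using assms(1) compactin_imp_mbounded by (simp add: compact_space_def mtopology_of_def)
  then obtain B where "\<And>x y. x \<in> mspace m \<Longrightarrow> y \<in> mspace m \<Longrightarrow> mdist m x y \<le> B"
    unfolding mbounded_alt by blast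
  then have "bdd_above ((\<lambda>(x, y). mdist m x y) ` (mspace m \<times> mspace m))"
    by (intro bdd_aboveI[of _ B]) auto
  then show ?thesis
    unfolding mdiameter_def using assms by (intro cSUP_upper2[of _ _ "(x, y)"]) auto
qed

lemma DC1_factor:
  assumes "inj e" "\<And>x. x \<in> extension \<Longrightarrow> f (proj x) = proj (step x)"
  shows "DC1 (embedded_metric e (proj ` extension)) (conj_map e e f)"
  unfolding DC1_def
proof (intro exI conjI ballI impI)
  let ?m = "embedded_metric e (proj ` extension)" and ?S = "(e \<circ> scrambled_point) ` {0..1::real}"
  have in_Y: "scrambled_point c \<in> proj ` extension" if "c \<in> {0..1}" for c
    unfolding scrambled_point_def using moving_in_extension[OF order_refl that] by (rule imageI)
  then show "?S \<subseteq> mspace ?m"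
    using assms(1) by (auto simp: mspace_embedded)
  \<comment> \<open>The second coordinate of \<open>scrambled_point c\<close> is
    \<open>2 * c\<close>.\<close>
  have "inj_on (e \<circ> scrambled_point) {0..1}"
    by (intro comp_inj_on inj_on_subset[OF assms(1)])
      (auto simp: inj_on_def scrambled_point_def proj_def profile_def)
  then show "uncountable ?S"
    by (simp only: countable_image_inj_eq) (simp add: uncountable_closed_interval)
  fix x y assume "x \<in> ?S" "y \<in> ?S" "x \<noteq> y"
  then obtain c c' where c: "c \<in> {0..1}" "c' \<in> {0..1}" "c \<noteq> c'"
      "x = e (scrambled_point c)" "y = e (scrambled_point c')"
    unfolding image_iff comp_def by blast
  have D: "dist ((f ^^ k) (scrambled_point c)) ((f ^^ k) (scrambled_point c')) = \<bar>c - c'\<bar> * gap k" for k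
    by (rule dist_scrambled_point) (use assms(2) c in auto)
  \<comment> \<open>Since \<open>gap 0 = 2\<close>, the initial distance already exceeds the
    threshold, which is therefore admissible for type 1.\<close>
  have "\<bar>c - c'\<bar> \<le> mdiameter ?m"
  proof -
    have "\<bar>c - c'\<bar> \<le> dist (scrambled_point c) (scrambled_point c')"
      using D[of 0] by (simp add: gap_def)
    also have "\<dots> = mdist ?m x y" using assms(1) c by (simp add: mdist_embedded)
    also have "\<dots> \<le> mdiameter ?m"
      using assms(1) c in_Y
      by (intro dist_le_mdiameter compact_space_embedded compact_continuous_image
          continuous_on_proj compact_extension) (auto simp: mspace_embedded)
    finally show ?thesis .
  qed
  then show "dist_scrambled1 ?m (conj_map e e f) x y"
    unfolding dist_scrambled1_def upper_distribution_def lower_distribution_def c(4,5)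
      close_frequency_embedded[OF assms(1)] D
    using c(3) limsup_frequency_gap liminf_frequency_gap
    by (intro conjI allI impI exI[of _ "\<bar>c - c'\<bar>"]) auto
qed

section \<open>Both systems on the prescribed carrier\<close>

theorem theorem1:
  shows "\<exists>(mX :: compact_metric_carrier metric) F (mY :: compact_metric_carrier metric) f \<pi>.
    topological_dynamical_system mX F \<and>
    topological_dynamical_system mY f \<and>
    semiconjugacy mX F mY f \<pi> \<and>
    DC1 mY f \<and>
    \<not> (\<exists>x1\<in>mspace mX. \<exists>x2\<in>mspace mX. dist_scrambled1 mX F x1 x2) \<and>
    \<not> (\<exists>x1\<in>mspace mX. \<exists>x2\<in>mspace mX. dist_scrambled2 mX F x1 x2)"
proof -
  \<comment> \<open>A tuple becomes a sequence whose last coordinate is repeated forever; its first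
    entries recover the tuple.\<close>
  define e :: "real \<times> real \<times> real \<times> real \<Rightarrow> compact_metric_carrier" where
    "e = (\<lambda>(a, b, c, d). case_nat a (case_nat b (case_nat c (\<lambda>_. d))))"
  define e' :: "real \<times> real \<Rightarrow> compact_metric_carrier" where
    "e' = (\<lambda>(a, b). case_nat a (\<lambda>_. b))"
  have e: "inj e"
  proof (rule inj_on_inverseI[where g = "\<lambda>x. (x 0, x 1, x 2, x 3)"])
    show "(e x 0, e x 1, e x 2, e x 3) = x" for x
      by (cases x) (simp add: e_def numeral_2_eq_2 numeral_3_eq_3)
  qed
  have e': "inj e'"
  proof (rule inj_on_inverseI[where g = "\<lambda>x. (x 0, x 1)"])
    show "(e' x 0, e' x 1) = x" for x
      by (cases x) (simp add: e'_def)
  qed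
  obtain f where f: "continuous_on (proj ` extension) f" "f ` (proj ` extension) \<subseteq> proj ` extension"
    "\<And>x. x \<in> extension \<Longrightarrow> f (proj x) = proj (step x)"
    using factor_map_exists by blast
  let ?X = "embedded_metric e extension" and ?Y = "embedded_metric e' (proj ` extension)"
  let ?F = "conj_map e e step" and ?f = "conj_map e' e' f" and ?\<pi> = "conj_map e e' proj"
  have ne: "extension \<noteq> {}" using moving_in_extension[of 1 0] by auto
  have DC1: "DC1 ?Y ?f"
    by (rule DC1_factor[OF e']) (rule f(3))
  have no2: "\<not> dist_scrambled2 ?X ?F x y" if "x \<in> mspace ?X" "y \<in> mspace ?X" for x y
    using that not_dist_scrambled2_extension[OF e] unfolding mspace_embedded[OF e] by (elim imageE) simp
  then have no1: "\<not> dist_scrambled1 ?X ?F x y" if "x \<in> mspace ?X" "y \<in> mspace ?X" for x y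
    using that dist_scrambled1_imp_2[of ?X ?F x y] by blast
  show ?thesis
  proof (intro exI conjI)
    show "topological_dynamical_system ?X ?F"
      unfolding topological_dynamical_system_def
    proof (intro conjI)
      show "mspace ?X \<noteq> {}" using e ne by (simp add: mspace_embedded)
      show "compact_space (mtopology_of ?X)"
        by (intro compact_space_embedded e compact_extension)
      show "continuous_map (mtopology_of ?X) (mtopology_of ?X) ?F"
        by (intro continuous_map_conj_map e continuous_on_step image_subsetI step_in_extension)
    qed
    show "topological_dynamical_system ?Y ?f"
      unfolding topological_dynamical_system_def
    proof (intro conjI)
      show "mspace ?Y \<noteq> {}" using e' ne by (simp add: mspace_embedded)
      show "compact_space (mtopology_of ?Y)"
        by (intro compact_space_embedded e' compact_continuous_image continuous_on_proj compact_extension)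
      show "continuous_map (mtopology_of ?Y) (mtopology_of ?Y) ?f"
        by (intro continuous_map_conj_map e' f)
    qed
    show "semiconjugacy ?X ?F ?Y ?f ?\<pi>"
      unfolding semiconjugacy_def
    proof (intro conjI)
      show "continuous_map (mtopology_of ?X) (mtopology_of ?Y) ?\<pi>"
        by (intro continuous_map_conj_map e e' continuous_on_proj order_refl)
      show "?\<pi> ` mspace ?X = mspace ?Y"
        using e e' by (simp add: mspace_embedded image_image conj_map_apply)
      show "\<forall>x\<in>mspace ?X. ?\<pi> (?F x) = ?f (?\<pi> x)"
        using e e' f(3) by (simp add: mspace_embedded conj_map_apply)
    qed
    show "DC1 ?Y ?f" by (fact DC1)
    show "\<not> (\<exists>x1\<in>mspace ?X. \<exists>x2\<in>mspace ?X. dist_scrambled1 ?X ?F x1 x2)"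
      using no1 by simp
    show "\<not> (\<exists>x1\<in>mspace ?X. \<exists>x2\<in>mspace ?X. dist_scrambled2 ?X ?F x1 x2)"
      using no2 by simp
  qed
qed

end
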